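(* Consider the single-item setting ($m=1$) in which the players' valuations are arbitrary. The Sequential Mechanism is $\alpha$-approximate with respect to social cost for each of the following cost functions: (1) Set Cover cost, with $\alpha=d$, where $d$ is the maximum cardinality of a set in $\mathcal{F}$; (2) Vertex Cover cost in a graph of maximum degree $k$, with $\alpha=k$; (3) Matching cost in a bipartite graph of maximum degree $k$, with $\alpha=k$; (4) Matching cost in a general graph of maximum degree $k$, with $\alpha=(5k+3)/4$.
   Context: Single item: an allocation is a set $T$ of served players with cost $c(T)$; each player $i$ has value $v_i\ge0$; social cost $\pi(T)=c(T)+\sum_{i\notin T}v_i$; $\alpha$-approximate means the output $T$ satisfies $\pi(T)\le\alpha\min_{T'}\pi(T')$ for all truthfully reported values. Sequential Mechanism (single item): process players in a fixed order; with $T$ the set served so far, player $i$ is served (added to $T$) iff her value strictly exceeds the price $c(T\cup\{i\})-c(T)$, which she then pays. Cost functions: (1) Set Cover: universe $U$ and family $\mathcal{F}\subseteq 2^U$ whose union is $U$; players are the elements of $U$; $c(S)$ is the minimum number of sets of $\mathcal{F}$ whose union contains $S$. (2) Vertex Cover: undirected unweighted graph $G=(V,E)$; players are the edges; $c(S)$ is the minimum size of a vertex set covering all edges in $S$. (3),(4) Matching: undirected unweighted graph $G=(V,E)$; players are the edges; $c(S)$ is the maximum cardinality of a matching contained in $S$. *)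

theory Defs
  imports Complex_Main
begin

definition seq_mech :: "('p set \<Rightarrow> real) \<Rightarrow> 'p list \<Rightarrow> ('p \<Rightarrow> real) \<Rightarrow> 'p set" where
  "seq_mech c ord v =
     foldl (\<lambda>T i. if v i > c (insert i T) - c T then insert i T else T) {} ord"

definition social_cost :: "('p set \<Rightarrow> real) \<Rightarrow> 'p set \<Rightarrow> ('p \<Rightarrow> real) \<Rightarrow> 'p set \<Rightarrow> real" where
  "social_cost c N v T = c T + (\<Sum>i\<in>N - T. v i)"

definition seq_approx :: "real \<Rightarrow> ('p set \<Rightarrow> real) \<Rightarrow> 'p set \<Rightarrow> bool" where
  "seq_approx \<alpha> c N \<longleftrightarrow>
     (\<forall>ord v. distinct ord \<and> set ord = N \<and> (\<forall>i\<in>N. v i \<ge> 0) \<longrightarrow>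
        (\<forall>T. T \<subseteq> N \<longrightarrow> social_cost c N v (seq_mech c ord v) \<le> \<alpha> * social_cost c N v T))"

definition setcover_cost :: "'a set set \<Rightarrow> 'a set \<Rightarrow> real" where
  "setcover_cost F S = real (LEAST k. \<exists>G. G \<subseteq> F \<and> finite G \<and> card G = k \<and> S \<subseteq> \<Union>G)"

definition simple_graph :: "'v set \<Rightarrow> 'v set set \<Rightarrow> bool" where
  "simple_graph V E \<longleftrightarrow> finite V \<and> (\<forall>e\<in>E. e \<subseteq> V \<and> card e = 2)"

definition degree :: "'v set set \<Rightarrow> 'v \<Rightarrow> nat" where
  "degree E x = card {e\<in>E. x \<in> e}"

definition max_degree_le :: "'v set \<Rightarrow> 'v set set \<Rightarrow> nat \<Rightarrow> bool" where
  "max_degree_le V E k \<longleftrightarrow> (\<forall>x\<in>V. degree E x \<le> k)"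

definition bipartite :: "'v set \<Rightarrow> 'v set set \<Rightarrow> bool" where
  "bipartite V E \<longleftrightarrow> (\<exists>A B. A \<inter> B = {} \<and> A \<union> B = V \<and>
       (\<forall>e\<in>E. \<exists>a\<in>A. \<exists>b\<in>B. e = {a, b}))"

definition vc_cost :: "'v set \<Rightarrow> 'v set set \<Rightarrow> real" where
  "vc_cost V S = real (LEAST k. \<exists>C. C \<subseteq> V \<and> card C = k \<and> (\<forall>e\<in>S. e \<inter> C \<noteq> {}))"

definition is_matching :: "'v set set \<Rightarrow> bool" where
  "is_matching M \<longleftrightarrow> (\<forall>e1\<in>M. \<forall>e2\<in>M. e1 \<noteq> e2 \<longrightarrow> e1 \<inter> e2 = {})"

definition matching_cost :: "'v set set \<Rightarrow> real" where
  "matching_cost S = real (Max (card ` {M. M \<subseteq> S \<and> is_matching M}))"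

end

theory Submission
  imports Defs
begin

text \<open>
  If the cost starts at \<open>0\<close> and every marginal cost is at most \<open>1\<close>, the Sequential Mechanism has
  social cost at most \<open>\<Sum>i. min (v i) 1\<close>. So it is \<open>\<alpha>\<close>-approximate as soon as
  \<open>card S \<le> \<alpha> * c S\<close> for all \<open>S\<close>. For Set Cover and Vertex Cover this is immediate. For Matching,
  one deletes vertices that are covered by all maximum matchings: each deletion removes at most
  \<open>k\<close> edges and lowers the matching number. A nonempty bipartite graph always has such a vertex
  (Koenig), which gives \<open>card S \<le> k * \<nu> S\<close>. A general graph without such a vertex satisfies a
  local form of Gallai's lemma: two vertices missed by the same maximum matching have no common
  neighbour. Counting edge ends then gives \<open>card S \<le> (k + 1) * \<nu> S\<close>, and
  \<open>k + 1 \<le> (5 * k + 3) / 4\<close> for \<open>k \<ge> 1\<close>.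
\<close>

section \<open>The Sequential Mechanism under unit marginal costs\<close>

lemma seq_mech_snoc:
  "seq_mech c (xs @ [i]) v =
     (if v i > c (insert i (seq_mech c xs v)) - c (seq_mech c xs v)
      then insert i (seq_mech c xs v) else seq_mech c xs v)"
  by (simp add: seq_mech_def)

lemma seq_mech_subset: "seq_mech c xs v \<subseteq> set xs"
  by (induction xs rule: rev_induct) (auto simp: seq_mech_snoc, simp add: seq_mech_def)

text \<open>Processing player \<open>i\<close> raises the social cost by at most
  \<open>min (v i) 1\<close>: a served player adds her marginal cost, which is below
  \<open>v i\<close> and at most 1; a refused one adds \<open>v i\<close>, which is at most the
  marginal cost.\<close>

lemma seq_mech_cost_le:
  assumes "c {} = 0"
    and "\<And>S i. S \<subseteq> N \<Longrightarrow> i \<in> N \<Longrightarrow> c (insert i S) \<le> c S + 1"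
    and "distinct xs" "set xs \<subseteq> N"
  shows "social_cost c (set xs) v (seq_mech c xs v) \<le> (\<Sum>i\<in>set xs. min (v i) 1)"
  using assms(3,4)
proof (induction xs rule: rev_induct)
  case Nil
  then show ?case by (simp add: seq_mech_def social_cost_def assms(1))
next
  case (snoc i xs)
  let ?T = "seq_mech c xs v"
  have sub: "?T \<subseteq> set xs" by (rule seq_mech_subset)
  have i: "i \<notin> set xs" "i \<notin> ?T" "i \<in> N" "?T \<subseteq> N" using snoc.prems sub by auto
  have marg: "c (insert i ?T) \<le> c ?T + 1" using assms(2) i by blast
  have IH: "c ?T + (\<Sum>j\<in>set xs - ?T. v j) \<le> (\<Sum>j\<in>set xs. min (v j) 1)"
    using snoc by (simp add: social_cost_def)
  have d1: "set (xs @ [i]) - insert i ?T = set xs - ?T" using i by auto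
  have d2: "set (xs @ [i]) - ?T = insert i (set xs - ?T)" using i by auto
  have s1: "(\<Sum>j\<in>set (xs @ [i]). min (v j) 1) = min (v i) 1 + (\<Sum>j\<in>set xs. min (v j) 1)"
    using i by simp
  show ?case
  proof (cases "v i > c (insert i ?T) - c ?T")
    case True
    then show ?thesis using IH marg unfolding social_cost_def seq_mech_snoc s1
      by (simp add: d1 del: set_append)
  next
    case False
    have "(\<Sum>j\<in>set (xs @ [i]) - ?T. v j) = v i + (\<Sum>j\<in>set xs - ?T. v j)"
      unfolding d2 using i by simp
    then show ?thesis using False IH marg unfolding social_cost_def seq_mech_snoc s1
      by simp
  qed
qed

text \<open>The bound \<open>min (v i) 1\<close> is split along the competing set \<open>T\<close>:
  inside \<open>T\<close> it is at most 1, in total \<open>card T\<close>; outside it is at most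
  \<open>v i\<close>. The condition 1 \<le> \<alpha> is guarded by \<open>N \<noteq> {}\<close>
  because \<open>d\<close> or \<open>k\<close> may be 0 when there are no players.\<close>

lemma seq_approxI:
  fixes c :: "'a set \<Rightarrow> real"
  assumes c0: "c {} = 0"
    and marg: "\<And>S i. S \<subseteq> N \<Longrightarrow> i \<in> N \<Longrightarrow> c (insert i S) \<le> c S + 1"
    and card: "\<And>S. S \<subseteq> N \<Longrightarrow> real (card S) \<le> \<alpha> * c S"
    and \<alpha>: "N \<noteq> {} \<Longrightarrow> 1 \<le> \<alpha>"
  shows "seq_approx \<alpha> c N"
  unfolding seq_approx_def
proof (intro allI impI, elim conjE)
  fix xs T and v :: "'a \<Rightarrow> real"
  assume d: "distinct xs" and N: "set xs = N" and v: "\<forall>i\<in>N. 0 \<le> v i" and T: "T \<subseteq> N"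
  have fin: "finite N" using N by auto
  have "social_cost c N v (seq_mech c xs v) \<le> (\<Sum>i\<in>N. min (v i) 1)"
    using seq_mech_cost_le[of c N xs v] c0 marg d N by auto
  also have "\<dots> = (\<Sum>i\<in>T. min (v i) 1) + (\<Sum>i\<in>N - T. min (v i) 1)"
    using sum.subset_diff[OF T fin] by (simp add: add.commute)
  also have "\<dots> \<le> (\<Sum>i\<in>T. 1) + (\<Sum>i\<in>N - T. v i)"
    by (intro add_mono sum_mono) auto
  also have "(\<Sum>i\<in>T. 1) \<le> \<alpha> * c T"
    using card[OF T] by simp
  also have "(\<Sum>i\<in>N - T. v i) \<le> \<alpha> * (\<Sum>i\<in>N - T. v i)"
  proof (cases "N = {}")
    case False
    have "0 \<le> (\<Sum>i\<in>N - T. v i)" using v by (intro sum_nonneg) auto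
    then show ?thesis using mult_right_mono[OF \<alpha>[OF False]] by fastforce
  qed simp
  finally show "social_cost c N v (seq_mech c xs v) \<le> \<alpha> * social_cost c N v T"
    by (simp add: social_cost_def distrib_left)
qed

section \<open>Covering costs\<close>

lemma setcover_cost_le:
  assumes "G \<subseteq> F" "finite G" "S \<subseteq> \<Union>G"
  shows "setcover_cost F S \<le> card G"
  unfolding setcover_cost_def of_nat_le_iff using assms by (intro Least_le) auto

lemma setcover_cost_attained:
  assumes "finite F" "S \<subseteq> \<Union>F"
  obtains G where "G \<subseteq> F" "finite G" "S \<subseteq> \<Union>G" "setcover_cost F S = card G"
proof -
  let ?P = "\<lambda>k. \<exists>G. G \<subseteq> F \<and> finite G \<and> card G = k \<and> S \<subseteq> \<Union>G"
  have "?P (card F)" using assms by blast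
  then have "?P (LEAST k. ?P k)" by (rule LeastI)
  then show thesis using that unfolding setcover_cost_def by force
qed

text \<open>Adding one set that contains \<open>i\<close> to an optimal cover bounds the marginal
  cost by 1. An optimal cover by \<open>card G\<close> sets of size at most \<open>d\<close>
  contains at most \<open>d * card G\<close> players.\<close>

lemma setcover_seq_approx:
  assumes "finite U" "F \<subseteq> Pow U" "\<Union>F = U" "\<forall>S\<in>F. card S \<le> d"
  shows "seq_approx (real d) (setcover_cost F) U"
proof (rule seq_approxI)
  have fF: "finite F" using finite_subset[OF assms(2)] assms(1) by simp
  have fin: "finite A" if "A \<in> F" for A
    using that assms(2) finite_subset[OF _ assms(1)] by auto
  show "setcover_cost F {} = 0"
    using setcover_cost_le[of "{}" F "{}"] by (simp add: setcover_cost_def)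
  fix S assume S: "S \<subseteq> U"
  obtain G where G: "G \<subseteq> F" "finite G" "S \<subseteq> \<Union>G" "setcover_cost F S = card G"
    using setcover_cost_attained[OF fF] S assms(3) by auto
  show "setcover_cost F (insert i S) \<le> setcover_cost F S + 1" if i: "i \<in> U" for i
  proof -
    obtain A where A: "A \<in> F" "i \<in> A" using i assms(3) by auto
    have "setcover_cost F (insert i S) \<le> card (insert A G)"
      using G A by (intro setcover_cost_le) auto
    also have "card (insert A G) \<le> card G + 1" by (simp add: card_insert_if G)
    finally show ?thesis using G(4) by simp
  qed
  have "card S \<le> card (\<Union>G)" using G fin by (intro card_mono) auto
  also have "\<dots> \<le> (\<Sum>A\<in>G. card A)" using card_Union_le_sum_card by blast
  also have "\<dots> \<le> (\<Sum>A\<in>G. d)" using assms(4) G by (intro sum_mono) auto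
  finally have "card S \<le> d * card G" by (simp add: mult.commute)
  then show "real (card S) \<le> real d * setcover_cost F S"
    unfolding G(4) by (metis of_nat_le_iff of_nat_mult)
next
  assume "U \<noteq> {}"
  then obtain x A where A: "x \<in> A" "A \<in> F" using assms(3) by blast
  then have "finite A" using assms(2) finite_subset[OF _ assms(1)] by auto
  then have "0 < card A" using A card_gt_0_iff by blast
  then show "1 \<le> real d" using A assms(4) by fastforce
qed

lemma vc_cost_le:
  assumes "C \<subseteq> V" "\<forall>e\<in>S. e \<inter> C \<noteq> {}"
  shows "vc_cost V S \<le> card C"
  unfolding vc_cost_def of_nat_le_iff using assms by (intro Least_le) auto

lemma vc_cost_attained:
  assumes "\<forall>e\<in>S. e \<inter> V \<noteq> {}"
  obtains C where "C \<subseteq> V" "\<forall>e\<in>S. e \<inter> C \<noteq> {}" "vc_cost V S = card C"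
proof -
  let ?P = "\<lambda>k. \<exists>C. C \<subseteq> V \<and> card C = k \<and> (\<forall>e\<in>S. e \<inter> C \<noteq> {})"
  have "?P (card V)" using assms by blast
  then have "?P (LEAST k. ?P k)" by (rule LeastI)
  then show thesis using that unfolding vc_cost_def by force
qed

lemma simple_graph_finite: "simple_graph V E \<Longrightarrow> finite E"
  unfolding simple_graph_def by (rule finite_subset[of E "Pow V"]) auto

lemma simple_graph_edge_meets: "simple_graph V E \<Longrightarrow> e \<in> E \<Longrightarrow> e \<inter> V \<noteq> {}"
  unfolding simple_graph_def by (fastforce simp: Int_absorb2)

lemma simple_graph_max_degree_pos:
  assumes "simple_graph V E" "max_degree_le V E k" "E \<noteq> {}"
  shows "1 \<le> k"
proof -
  obtain e x where e: "e \<in> E" "x \<in> e" "x \<in> V"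
    using simple_graph_edge_meets[OF assms(1)] assms(3) by (metis Int_emptyI equals0I)
  have "finite {e\<in>E. x \<in> e}" using simple_graph_finite[OF assms(1)] by simp
  then have "0 < card {e\<in>E. x \<in> e}" using e card_gt_0_iff by blast
  then show ?thesis using assms(2) e unfolding max_degree_le_def degree_def by force
qed

text \<open>Adding one endpoint of the new edge to an optimal cover bounds the marginal cost by 1,
  and each vertex of the cover meets at most \<open>k\<close> edges.\<close>

lemma vc_seq_approx:
  assumes g: "simple_graph V E" and deg: "max_degree_le V E k"
  shows "seq_approx (real k) (vc_cost V) E"
proof (rule seq_approxI)
  show "vc_cost V {} = 0"
    using vc_cost_le[of "{}" V "{}"] by (simp add: vc_cost_def)
  fix S assume S: "S \<subseteq> E"
  have "\<forall>e\<in>S. e \<inter> V \<noteq> {}" using simple_graph_edge_meets[OF g] S by auto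
  from vc_cost_attained[OF this] obtain C
    where C: "C \<subseteq> V" "\<forall>e\<in>S. e \<inter> C \<noteq> {}" "vc_cost V S = card C" .
  have "finite V" using g unfolding simple_graph_def by simp
  then have fin: "finite C" "finite E"
    using finite_subset[OF C(1)] simple_graph_finite[OF g] by auto
  show "vc_cost V (insert i S) \<le> vc_cost V S + 1" if i: "i \<in> E" for i
  proof -
    obtain x where x: "x \<in> i" "x \<in> V" using simple_graph_edge_meets[OF g i] by auto
    have "vc_cost V (insert i S) \<le> card (insert x C)"
      using C x by (intro vc_cost_le) auto
    also have "card (insert x C) \<le> card C + 1" by (simp add: card_insert_if fin)
    finally show ?thesis using C(3) by simp
  qed
  have "card S \<le> card (\<Union>x\<in>C. {e\<in>E. x \<in> e})"
    using C(2) S fin by (intro card_mono) auto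
  also have "\<dots> \<le> (\<Sum>x\<in>C. card {e\<in>E. x \<in> e})" using fin by (intro card_UN_le)
  also have "\<dots> \<le> (\<Sum>x\<in>C. k)"
    using deg C unfolding max_degree_le_def degree_def by (intro sum_mono) auto
  finally have "card S \<le> k * card C" by (simp add: mult.commute)
  then show "real (card S) \<le> real k * vc_cost V S"
    unfolding C(3) by (metis of_nat_le_iff of_nat_mult)
qed (use simple_graph_max_degree_pos[OF assms] in simp)

section \<open>Maximum matchings\<close>

definition max_matching :: "'v set set \<Rightarrow> 'v set set \<Rightarrow> bool" where
  "max_matching S M \<longleftrightarrow> M \<subseteq> S \<and> is_matching M \<and>
     (\<forall>M'. M' \<subseteq> S \<and> is_matching M' \<longrightarrow> card M' \<le> card M)"

lemma max_matchingD:
  assumes "max_matching S M"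
  shows "M \<subseteq> S" "is_matching M" "\<And>M'. M' \<subseteq> S \<Longrightarrow> is_matching M' \<Longrightarrow> card M' \<le> card M"
  using assms by (auto simp: max_matching_def)

lemma matching_cost_attained:
  assumes "finite S"
  obtains M where "max_matching S M" "matching_cost S = card M"
proof -
  let ?A = "card ` {M. M \<subseteq> S \<and> is_matching M}"
  have fin: "finite ?A" using assms by auto
  have "{} \<in> {M. M \<subseteq> S \<and> is_matching M}" by (simp add: is_matching_def)
  then have "Max ?A \<in> ?A" using fin by (intro Max_in) auto
  then obtain M where M: "M \<subseteq> S" "is_matching M" "card M = Max ?A" by auto
  have "max_matching S M" unfolding max_matching_def
    using M Max_ge[OF fin] by auto
  then show thesis using that M by (simp add: matching_cost_def)
qed

text \<open>An edge with no end covered by \<open>M\<close> could be added to \<open>M\<close>.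
  Nonemptiness of \<open>e\<close> ensures that such an edge is not already in
  \<open>M\<close>.\<close>

lemma max_matching_covers_edge:
  assumes "finite S" "max_matching S M" "e \<in> S" "e \<noteq> {}"
  shows "e \<inter> \<Union>M \<noteq> {}"
proof
  assume *: "e \<inter> \<Union>M = {}"
  have "finite M" using finite_subset[OF max_matchingD(1)[OF assms(2)] assms(1)] .
  moreover have "e \<notin> M" using assms(4) * by auto
  ultimately have "card (insert e M) = Suc (card M)" by simp
  moreover have "is_matching (insert e M)"
    using * max_matchingD(2)[OF assms(2)] unfolding is_matching_def by blast
  then have "card (insert e M) \<le> card M"
    using assms(2,3) max_matchingD(1)[OF assms(2)] by (intro max_matchingD(3)[OF assms(2)]) auto
  ultimately show False by simp
qed

lemma card_Union_matching:
  assumes "finite M" "is_matching M" "\<forall>e\<in>M. card e = 2"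
  shows "card (\<Union>M) = 2 * card M"
proof -
  have "card (\<Union>M) = (\<Sum>e\<in>M. card e)"
  proof (rule card_Union_disjoint)
    show "pairwise disjnt M"
      using assms(2) unfolding is_matching_def pairwise_def disjnt_def by blast
    show "\<And>e. e \<in> M \<Longrightarrow> finite e" using assms(3) by (metis card.infinite zero_neq_numeral)
  qed
  then show ?thesis using assms(3) by simp
qed

text \<open>Stands in for the connected component of \<open>y\<close>: a maximal set \<open>X\<close> satisfying the
  cardinality bound is closed under \<open>K\<close>, since an edge leaving \<open>X\<close> could be added to it.\<close>

lemma closed_vertex_set_exists:
  assumes "finite V" "finite K" "\<forall>e\<in>K. e \<subseteq> V \<and> card e = 2" "y \<in> V"
  obtains X where "X \<subseteq> V" "y \<in> X" "card X \<le> card {e\<in>K. e \<subseteq> X} + 1"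
    "\<forall>e\<in>K. e \<inter> X \<noteq> {} \<longrightarrow> e \<subseteq> X"
proof -
  let ?A = "{X. X \<subseteq> V \<and> y \<in> X \<and> card X \<le> card {e\<in>K. e \<subseteq> X} + 1}"
  have "finite ?A" using assms(1) by simp
  moreover have "{y} \<in> ?A" using assms(4) by simp
  ultimately obtain X where X: "X \<in> ?A" "\<forall>Y\<in>?A. X \<subseteq> Y \<longrightarrow> X = Y"
    using finite_has_maximal[of ?A] by blast
  have finX: "finite X" using X assms(1) finite_subset by auto
  have "e \<subseteq> X" if e: "e \<in> K" "e \<inter> X \<noteq> {}" for e
  proof (rule ccontr)
    assume n: "\<not> e \<subseteq> X"
    obtain a b where ab: "e = {a, b}" "a \<noteq> b" using assms(3) e by (meson card_2_iff)
    then obtain w where w: "w \<in> e" "w \<notin> X" "e \<subseteq> insert w X" using n e(2) by auto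
    \<comment> \<open>Adding \<open>w\<close> costs one vertex and gains at least the edge
      \<open>e\<close>, so the cardinality bound survives.\<close>
    have "{e\<in>K. e \<subseteq> X} \<subset> {e\<in>K. e \<subseteq> insert w X}" using w e n by auto
    then have "card {e\<in>K. e \<subseteq> X} < card {e\<in>K. e \<subseteq> insert w X}"
      using assms(2) by (intro psubset_card_mono) auto
    then have "insert w X \<in> ?A" using X(1) finX w assms(3) e by auto
    from mp[OF bspec[OF X(2) this] subset_insertI] have "X = insert w X" .
    then show False using w(2) by auto
  qed
  then have "\<forall>e\<in>K. e \<inter> X \<noteq> {} \<longrightarrow> e \<subseteq> X" by simp
  moreover have "X \<subseteq> V" "y \<in> X" "card X \<le> card {e\<in>K. e \<subseteq> X} + 1" using X(1) by simp_all
  ultimately show thesis using that by metis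
qed

section \<open>Swapping one matching for another inside a closed vertex set\<close>

definition exchange :: "'v set \<Rightarrow> 'v set set \<Rightarrow> 'v set set \<Rightarrow> 'v set set" where
  "exchange X M N = {e\<in>M. \<not> e \<subseteq> X} \<union> {e\<in>N. e \<subseteq> X}"

lemma card_exchange:
  assumes "finite M" "finite N"
  shows "card (exchange X M N) + card {e\<in>M. e \<subseteq> X} = card M + card {e\<in>N. e \<subseteq> X}"
proof -
  have "card (exchange X M N) = card {e\<in>M. \<not> e \<subseteq> X} + card {e\<in>N. e \<subseteq> X}"
    unfolding exchange_def using assms by (intro card_Un_disjoint) auto
  moreover have "card M = card {e\<in>M. \<not> e \<subseteq> X} + card {e\<in>M. e \<subseteq> X}"
    using assms by (subst card_Un_disjoint[symmetric]) (auto intro: arg_cong[where f = card])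
  ultimately show ?thesis by simp
qed

text \<open>Closure of \<open>X\<close> under \<open>M\<close> makes the kept edges of
  \<open>M\<close> disjoint from \<open>X\<close>, so they cannot meet the inserted edges of
  \<open>N\<close>.\<close>

lemma is_matching_exchange:
  assumes "is_matching M" "is_matching N" "\<forall>e\<in>M. e \<inter> X \<noteq> {} \<longrightarrow> e \<subseteq> X"
  shows "is_matching (exchange X M N)"
  unfolding is_matching_def exchange_def
proof (intro ballI impI)
  fix e f assume e: "e \<in> {e\<in>M. \<not> e \<subseteq> X} \<union> {e\<in>N. e \<subseteq> X}"
    and f: "f \<in> {e\<in>M. \<not> e \<subseteq> X} \<union> {e\<in>N. e \<subseteq> X}" and ne: "e \<noteq> f"
  have dM: "g \<inter> X = {}" if "g \<in> M" "\<not> g \<subseteq> X" for g using that assms(3) by blast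
  show "e \<inter> f = {}" using e f
  proof (elim UnE)
    assume "e \<in> {e\<in>M. \<not> e \<subseteq> X}" "f \<in> {e\<in>M. \<not> e \<subseteq> X}"
    then show ?thesis using assms(1) ne unfolding is_matching_def by blast
  next
    assume "e \<in> {e\<in>N. e \<subseteq> X}" "f \<in> {e\<in>N. e \<subseteq> X}"
    then show ?thesis using assms(2) ne unfolding is_matching_def by blast
  qed (use dM in blast)+
qed

text \<open>The exchanged set is a matching in \<open>S\<close>, hence no larger than
  \<open>M\<close>; \<open>card_exchange\<close> turns this into a comparison inside
  \<open>X\<close>.\<close>

lemma max_matching_exchange_le:
  assumes "finite S" "max_matching S M" "max_matching S N"
    and "\<forall>e\<in>M. e \<inter> X \<noteq> {} \<longrightarrow> e \<subseteq> X"
  shows "card {e\<in>N. e \<subseteq> X} \<le> card {e\<in>M. e \<subseteq> X}"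
proof -
  have "finite M" "finite N"
    using finite_subset[OF max_matchingD(1)] assms(1-3) by metis+
  moreover have "exchange X M N \<subseteq> S"
    using max_matchingD(1)[OF assms(2)] max_matchingD(1)[OF assms(3)]
    unfolding exchange_def by auto
  then have "card (exchange X M N) \<le> card M"
    using is_matching_exchange[OF max_matchingD(2)[OF assms(2)] max_matchingD(2)[OF assms(3)] assms(4)]
    by (rule max_matchingD(3)[OF assms(2)])
  ultimately show ?thesis using card_exchange[of M N X] by simp
qed

text \<open>With \<open>X\<close> closed under both matchings the inequality holds in both
  directions, so the swap preserves the cardinality.\<close>

lemma max_matching_exchange:
  assumes "finite S" "max_matching S M" "max_matching S N"
    and "\<forall>e\<in>M \<union> N. e \<inter> X \<noteq> {} \<longrightarrow> e \<subseteq> X"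
  shows "max_matching S (exchange X M N)"
    and "card {e\<in>N. e \<subseteq> X} = card {e\<in>M. e \<subseteq> X}"
proof -
  have fin: "finite M" "finite N"
    using finite_subset[OF max_matchingD(1)] assms(1-3) by metis+
  show eq: "card {e\<in>N. e \<subseteq> X} = card {e\<in>M. e \<subseteq> X}"
    using assms(4)
    by (intro le_antisym max_matching_exchange_le[OF assms(1,2,3)]
        max_matching_exchange_le[OF assms(1,3,2)]) simp_all
  have "card (exchange X M N) = card M" using card_exchange[OF fin, of X] eq by simp
  moreover have "exchange X M N \<subseteq> S"
    using max_matchingD(1)[OF assms(2)] max_matchingD(1)[OF assms(3)]
    unfolding exchange_def by auto
  moreover have "is_matching (exchange X M N)"
    using is_matching_exchange[OF max_matchingD(2)[OF assms(2)] max_matchingD(2)[OF assms(3)]]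
      assms(4) by blast
  ultimately show "max_matching S (exchange X M N)"
    using max_matchingD(3)[OF assms(2)] unfolding max_matching_def by simp
qed

lemma max_matching_closed_set:
  assumes "finite S" "\<forall>e\<in>S. card e = 2" "max_matching S M" "max_matching S N"
  obtains X where "finite X" "y \<in> X"
    "card X \<le> card {e\<in>M. e \<subseteq> X} + card {e\<in>N. e \<subseteq> X} + 1"
    "\<forall>e\<in>M \<union> N. e \<inter> X \<noteq> {} \<longrightarrow> e \<subseteq> X"
proof -
  have sub: "M \<subseteq> S" "N \<subseteq> S" using max_matchingD(1) assms(3,4) by metis+
  have fe: "finite e" if "e \<in> S" for e
    using assms(2) that by (metis card.infinite zero_neq_numeral)
  \<comment> \<open>\<open>y\<close> is inserted because it may lie on no edge of
    \<open>S\<close>.\<close>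
  have fV: "finite (insert y (\<Union>S))" using fe assms(1) by simp
  have fMN: "finite (M \<union> N)" using sub assms(1) finite_subset by blast
  have e2: "\<forall>e\<in>M \<union> N. e \<subseteq> insert y (\<Union>S) \<and> card e = 2"
    using sub assms(2) by auto
  obtain X where X: "X \<subseteq> insert y (\<Union>S)" "y \<in> X" "card X \<le> card {e\<in>M \<union> N. e \<subseteq> X} + 1"
    "\<forall>e\<in>M \<union> N. e \<inter> X \<noteq> {} \<longrightarrow> e \<subseteq> X"
    using closed_vertex_set_exists[OF fV fMN e2] by blast
  have "{e\<in>M \<union> N. e \<subseteq> X} = {e\<in>M. e \<subseteq> X} \<union> {e\<in>N. e \<subseteq> X}" by auto
  then have "card {e\<in>M \<union> N. e \<subseteq> X} \<le> card {e\<in>M. e \<subseteq> X} + card {e\<in>N. e \<subseteq> X}"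
    by (simp only: card_Un_le)
  then have "card X \<le> card {e\<in>M. e \<subseteq> X} + card {e\<in>N. e \<subseteq> X} + 1" using X(3) by simp
  then show thesis using that[OF finite_subset[OF X(1) fV] X(2) _ X(4)] by simp
qed

section \<open>Vertices missed by some maximum matching\<close>

lemma max_matching_missing_pair:
  assumes S: "finite S" "\<forall>e\<in>S. card e = 2"
    and M: "max_matching S M" "x \<notin> \<Union>M" "z \<notin> \<Union>M" "x \<noteq> z"
    and N: "max_matching S N" "y \<notin> \<Union>N"
  obtains L where "max_matching S L" "y \<notin> \<Union>L" "x \<notin> \<Union>L \<or> z \<notin> \<Union>L"
proof -
  obtain X where X: "finite X" "y \<in> X"
    "card X \<le> card {e\<in>M. e \<subseteq> X} + card {e\<in>N. e \<subseteq> X} + 1"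
    "\<forall>e\<in>M \<union> N. e \<inter> X \<noteq> {} \<longrightarrow> e \<subseteq> X"
    using max_matching_closed_set[OF S M(1) N(1)] .
  note exch = max_matching_exchange[OF S(1) M(1) N(1) X(4)]
  \<comment> \<open>If \<open>X\<close> contained both, the edges of \<open>M\<close> inside
    \<open>X\<close> would miss two of its vertices, so \<open>card X\<close> would be at least
    twice their number plus 2. The bound on \<open>X\<close> allows only plus 1, since
    \<open>M\<close> and \<open>N\<close> have equally many edges inside \<open>X\<close>.\<close>
  have "x \<notin> X \<or> z \<notin> X"
  proof (rule ccontr)
    assume xz: "\<not> (x \<notin> X \<or> z \<notin> X)"
    let ?M = "{e\<in>M. e \<subseteq> X}"
    have "finite ?M" using finite_subset[OF max_matchingD(1)[OF M(1)] S(1)] by simp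
    then have "card (\<Union>?M) = 2 * card ?M"
      using max_matchingD(1,2)[OF M(1)] S(2)
      by (intro card_Union_matching) (auto simp: is_matching_def)
    moreover have "card (\<Union>?M) \<le> card (X - {x, z})"
      using X(1) M(2,3) by (intro card_mono) auto
    moreover have "card (X - {x, z}) + 2 = card X"
      using xz M(4) X(1) card_mono[of X "{x, z}"] by (simp add: card_Diff_subset)
    ultimately show False using X(3) exch(2) by simp
  qed
  \<comment> \<open>The one of \<open>x\<close> and \<open>z\<close> outside \<open>X\<close> keeps
    its status from \<open>M\<close>, while \<open>y\<close> inside \<open>X\<close> takes its
    status from \<open>N\<close>.\<close>
  then have "x \<notin> \<Union>(exchange X M N) \<or> z \<notin> \<Union>(exchange X M N)"
    using M unfolding exchange_def by auto
  moreover have "y \<notin> \<Union>(exchange X M N)"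
    using N(2) X(2,4) unfolding exchange_def by auto
  ultimately show thesis using that exch(1) by blast
qed

text \<open>The local form of Gallai's lemma: otherwise some maximum matching misses
  \<open>y\<close> together with \<open>x\<close> or \<open>z\<close>, leaving an edge of
  \<open>S\<close> with both ends uncovered.\<close>

lemma common_neighbour_covered:
  assumes S: "finite S" "\<forall>e\<in>S. card e = 2"
    and M: "max_matching S M" "x \<notin> \<Union>M" "z \<notin> \<Union>M" "x \<noteq> z"
    and e: "{x, y} \<in> S" "{z, y} \<in> S"
    and N: "max_matching S N"
  shows "y \<in> \<Union>N"
proof (rule ccontr)
  assume "y \<notin> \<Union>N"
  then obtain L where L: "max_matching S L" "y \<notin> \<Union>L" "x \<notin> \<Union>L \<or> z \<notin> \<Union>L"
    using max_matching_missing_pair[OF S M N] by metis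
  then show False
    using max_matching_covers_edge[OF S(1) L(1) e(1)] max_matching_covers_edge[OF S(1) L(1) e(2)]
    by auto
qed

text \<open>Picking an end in \<open>A\<close> for each edge is injective on a matching; the
  uncovered vertex \<open>u\<close> is never picked, which makes the inequality strict.\<close>

lemma card_matching_within_le_side:
  assumes "finite M" "is_matching M" "\<forall>e\<in>M. \<exists>a\<in>A. a \<in> e" "finite X" "u \<in> X" "u \<in> A" "u \<notin> \<Union>M"
  shows "card {e\<in>M. e \<subseteq> X} < card (X \<inter> A)"
proof -
  obtain f where f: "\<forall>e\<in>M. f e \<in> A \<and> f e \<in> e" using assms(3) by metis
  have "inj_on f {e\<in>M. e \<subseteq> X}"
    using f assms(2) unfolding inj_on_def is_matching_def
    by (metis (no_types, lifting) IntI empty_iff mem_Collect_eq)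
  moreover have "f ` {e\<in>M. e \<subseteq> X} \<subseteq> X \<inter> A - {u}" using f assms(7) by auto
  ultimately have "card {e\<in>M. e \<subseteq> X} \<le> card (X \<inter> A - {u})"
    using assms(4) by (intro card_inj_on_le) auto
  also have "\<dots> < card (X \<inter> A)" using assms by (intro card_Diff1_less) auto
  finally show ?thesis .
qed

text \<open>Koenig's argument: if \<open>M\<close> misses \<open>u\<close> and \<open>N\<close>
  misses \<open>v\<close>, swapping \<open>N\<close> for \<open>M\<close> on a closed set around
  \<open>u\<close> produces a maximum matching missing both ends of an edge.\<close>

lemma bipartite_edge_end_covered:
  assumes S: "finite S" "\<forall>e\<in>S. \<exists>a\<in>A. \<exists>b\<in>B. e = {a, b}" and AB: "A \<inter> B = {}"
    and uv: "{u, v} \<in> S" "u \<in> A" "v \<in> B"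
    and M: "max_matching S M" "u \<notin> \<Union>M" and N: "max_matching S N"
  shows "v \<in> \<Union>N"
proof (rule ccontr)
  assume v: "v \<notin> \<Union>N"
  have "\<forall>e\<in>S. card e = 2" using S(2) AB by (fastforce simp: card_2_iff)
  from max_matching_closed_set[OF S(1) this N M(1)] obtain X where X: "finite X" "u \<in> X"
    "card X \<le> card {e\<in>N. e \<subseteq> X} + card {e\<in>M. e \<subseteq> X} + 1"
    "\<forall>e\<in>N \<union> M. e \<inter> X \<noteq> {} \<longrightarrow> e \<subseteq> X"
    .
  have sub: "M \<subseteq> S" "N \<subseteq> S" using max_matchingD(1) M(1) N by metis+
  have fin: "finite M" "finite N" using sub S(1) finite_subset by blast+
  \<comment> \<open>If \<open>v\<close> were in \<open>X\<close>, the strict bounds on the two sides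
    would give \<open>card X\<close> at least two more than the edges of \<open>M\<close> and
    \<open>N\<close> inside \<open>X\<close> counted together, against the bound of one
    more.\<close>
  have "v \<notin> X"
  proof
    assume vX: "v \<in> X"
    have "card {e\<in>M. e \<subseteq> X} < card (X \<inter> A)"
      using sub S(2)
      by (intro card_matching_within_le_side[OF fin(1) max_matchingD(2)[OF M(1)] _ X(1,2) uv(2) M(2)])
        blast
    moreover have "card {e\<in>N. e \<subseteq> X} < card (X \<inter> B)"
      using sub S(2)
      by (intro card_matching_within_le_side[OF fin(2) max_matchingD(2)[OF N] _ X(1) vX uv(3) v])
        blast
    moreover have "card (X \<inter> A) + card (X \<inter> B) \<le> card X"
      using X(1) AB by (subst card_Un_disjoint[symmetric]) (auto intro!: card_mono)
    ultimately show False using X(3) by simp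
  qed
  then have "{u, v} \<inter> \<Union>(exchange X N M) = {}"
    using v M(2) X(2,4) unfolding exchange_def by auto
  moreover have "max_matching S (exchange X N M)"
    by (rule max_matching_exchange[OF S(1) N M(1) X(4)])
  ultimately show False using max_matching_covers_edge[OF S(1) _ uv(1)] by blast
qed

section \<open>Edges versus matching number\<close>

text \<open>If deleting \<open>w\<close> did not lower the matching number, \<open>L\<close> would
  be a maximum matching of \<open>S\<close> that misses \<open>w\<close>.\<close>

lemma max_matching_delete_covered:
  assumes S: "finite S" and w: "\<And>N. max_matching S N \<Longrightarrow> w \<in> \<Union>N"
    and M: "max_matching S M" and L: "max_matching {e\<in>S. w \<notin> e} L"
  shows "card L < card M"
proof (rule ccontr)
  assume n: "\<not> card L < card M"
  have "L \<subseteq> S" "w \<notin> \<Union>L" using max_matchingD(1)[OF L] by auto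
  moreover have "card M' \<le> card L" if "M' \<subseteq> S" "is_matching M'" for M'
    using n max_matchingD(3)[OF M that] by simp
  ultimately have "max_matching S L"
    using max_matchingD(2)[OF L] unfolding max_matching_def by simp
  then show False using w \<open>w \<notin> \<Union>L\<close> by blast
qed

text \<open>The induction step shared by the bipartite and the general bound, with the induction
  hypothesis as an assumption: at most \<open>k\<close> edges are lost and the matching number drops
  by at least one.\<close>

lemma card_le_delete_covered:
  assumes S: "finite S" and w: "\<And>N. max_matching S N \<Longrightarrow> w \<in> \<Union>N"
    and deg: "card {e\<in>S. w \<in> e} \<le> k" and M: "max_matching S M"
    and IH: "\<And>L. max_matching {e\<in>S. w \<notin> e} L \<Longrightarrow> card {e\<in>S. w \<notin> e} \<le> k * card L"
  shows "card S \<le> k * card M"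
proof -
  have "finite {e\<in>S. w \<notin> e}" using S by simp
  then obtain L where L: "max_matching {e\<in>S. w \<notin> e} L"
    using matching_cost_attained by metis
  have "card S = card ({e\<in>S. w \<in> e} \<union> {e\<in>S. w \<notin> e})"
    by (rule arg_cong[where f = card]) auto
  also have "\<dots> \<le> card {e\<in>S. w \<in> e} + card {e\<in>S. w \<notin> e}" by (rule card_Un_le)
  also have "\<dots> \<le> k + k * card L" using deg IH[OF L] by (rule add_mono)
  also have "\<dots> = k * Suc (card L)" by simp
  also have "\<dots> \<le> k * card M"
    using max_matching_delete_covered[OF S w M L] by (intro mult_le_mono2) simp
  finally show ?thesis .
qed

lemma card_delete_less:
  assumes "finite S" "e \<in> S" "w \<in> e"
  shows "card {e\<in>S. w \<notin> e} < card S"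
  using assms by (intro psubset_card_mono) auto

lemma card_deg_subset:
  assumes "finite S" "T \<subseteq> S" "card {e\<in>S. w \<in> e} \<le> k"
  shows "card {e\<in>T. w \<in> e} \<le> k"
proof -
  have "card {e\<in>T. w \<in> e} \<le> card {e\<in>S. w \<in> e}" using assms by (intro card_mono) auto
  then show ?thesis using assms(3) by simp
qed

lemma bipartite_card_le:
  assumes "finite S" "\<forall>e\<in>S. \<exists>a\<in>A. \<exists>b\<in>B. e = {a, b}" "A \<inter> B = {}"
    and "\<And>x. card {e\<in>S. x \<in> e} \<le> k" "max_matching S M"
  shows "card S \<le> k * card M"
  using assms
proof (induction "card S" arbitrary: S M rule: less_induct)
  case less
  show ?case
  proof (cases "S = {}")
    case False
    then obtain e where "e \<in> S" by auto
    then obtain u v where uv: "{u, v} \<in> S" "u \<in> A" "v \<in> B" using less.prems(2) by metis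
    \<comment> \<open>If some maximum matching misses \<open>u\<close>, then all of them cover
      \<open>v\<close>.\<close>
    have "\<exists>w\<in>{u, v}. \<forall>N. max_matching S N \<longrightarrow> w \<in> \<Union>N"
      using bipartite_edge_end_covered[OF less.prems(1-3) uv] by (metis insert_iff)
    then obtain w where w: "w \<in> {u, v}" "\<And>N. max_matching S N \<Longrightarrow> w \<in> \<Union>N" by metis
    let ?T = "{e\<in>S. w \<notin> e}"
    show ?thesis
    proof (rule card_le_delete_covered[OF less.prems(1) w(2) less.prems(4,5)])
      fix L assume L: "max_matching ?T L"
      show "card ?T \<le> k * card L"
      proof (rule less.hyps[OF _ _ _ _ _ L])
        show "card ?T < card S" by (rule card_delete_less[OF less.prems(1) uv(1) w(1)])
        show "card {e\<in>?T. x \<in> e} \<le> k" for x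
          by (rule card_deg_subset[OF less.prems(1) _ less.prems(4)]) auto
      qed (use less.prems in auto)
    qed
  qed simp
qed

text \<open>\<open>M\<close> covers \<open>2 * card M\<close> vertices, each on at most
  \<open>k\<close> edges and on at most one edge leaving the covered set. Counting edge ends gives
  \<open>2 * card S \<le> 2 * card M * k + 2 * card M\<close>.\<close>

lemma card_le_no_essential_vertex:
  assumes S: "finite S" "\<forall>e\<in>S. card e = 2" and deg: "\<And>x. card {e\<in>S. x \<in> e} \<le> k"
    and M: "max_matching S M" and ne: "\<And>w. \<exists>N. max_matching S N \<and> w \<notin> \<Union>N"
  shows "card S \<le> (k + 1) * card M"
proof -
  let ?W = "\<Union>M"
  define T where "T = {e\<in>S. \<not> e \<subseteq> ?W}"
  have fe: "finite e" if "e \<in> S" for e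
    using S(2) that by (metis card.infinite zero_neq_numeral)
  have sub: "M \<subseteq> S" using max_matchingD(1)[OF M] .
  have finM: "finite M" using sub S(1) finite_subset by blast
  have cW: "card ?W = 2 * card M"
    using card_Union_matching[OF finM max_matchingD(2)[OF M]] sub S(2) by auto
  have finW: "finite ?W" using finM sub fe by auto
  have meets: "e \<inter> ?W \<noteq> {}" if "e \<in> S" for e
    using max_matching_covers_edge[OF S(1) M that] S(2) that by fastforce
  have "\<forall>e\<in>T. \<exists>w u. w \<in> ?W \<and> u \<notin> ?W \<and> e = {u, w}"
  proof
    fix e assume e: "e \<in> T"
    then have "card e = 2" using S(2) unfolding T_def by simp
    then obtain a b where ab: "e = {a, b}" by (auto simp: card_2_iff)
    have "e \<inter> ?W \<noteq> {}" "\<not> e \<subseteq> ?W" using meets e unfolding T_def by auto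
    then show "\<exists>w u. w \<in> ?W \<and> u \<notin> ?W \<and> e = {u, w}" unfolding ab by blast
  qed
  then obtain f g where fg: "\<And>e. e \<in> T \<Longrightarrow> f e \<in> ?W \<and> g e \<notin> ?W \<and> e = {g e, f e}"
    by metis
  \<comment> \<open>Two edges of \<open>T\<close> sharing the covered end \<open>f e\<close> would
    make it a common neighbour of two vertices missed by \<open>M\<close>, hence covered by every
    maximum matching, against \<open>ne\<close>.\<close>
  have "inj_on f T"
  proof (rule inj_onI)
    fix e e' assume e: "e \<in> T" "e' \<in> T" "f e = f e'"
    have "e \<in> S" "e' \<in> S" using e unfolding T_def by auto
    then have "{g e, f e} \<in> S" "{g e', f e} \<in> S" using fg e by metis+
    then have "g e = g e'"
      using common_neighbour_covered[OF S M, of "g e" "g e'" "f e"] fg e ne by metis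
    then show "e = e'" using fg e by metis
  qed
  then have cT: "card T \<le> 2 * card M"
    using cW fg finW by (metis card_inj_on_le image_subsetI)
  have "2 * card S = (\<Sum>e\<in>S. 2)" by simp
  \<comment> \<open>The indicator of \<open>T\<close> pays for the one end that an edge may have
    outside \<open>?W\<close>.\<close>
  also have "\<dots> \<le> (\<Sum>e\<in>S. card (e \<inter> ?W) + (if e \<in> T then 1 else 0))"
  proof (rule sum_mono)
    fix e assume e: "e \<in> S"
    show "2 \<le> card (e \<inter> ?W) + (if e \<in> T then 1 else 0)"
    proof (cases "e \<in> T")
      case True
      have "0 < card (e \<inter> ?W)" using meets[OF e] fe[OF e] by (simp add: card_gt_0_iff)
      then show ?thesis using True by simp
    next
      case False
      then have "e \<inter> ?W = e" using e unfolding T_def by auto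
      then show ?thesis using S(2) e by simp
    qed
  qed
  also have "\<dots> = (\<Sum>e\<in>S. card (e \<inter> ?W)) + card T"
    using S(1) by (simp add: sum.distrib T_def sum.If_cases Int_def)
  also have "(\<Sum>e\<in>S. card (e \<inter> ?W)) = (\<Sum>e\<in>S. \<Sum>x\<in>?W. if x \<in> e then 1 else 0)"
    using finW by (simp add: sum.If_cases Int_commute Int_def conj_commute)
  also have "\<dots> = (\<Sum>x\<in>?W. \<Sum>e\<in>S. if x \<in> e then 1 else 0)" by (rule sum.swap)
  also have "\<dots> = (\<Sum>x\<in>?W. card {e\<in>S. x \<in> e})"
    using S(1) by (simp add: sum.If_cases Int_def)
  also have "\<dots> \<le> (\<Sum>x\<in>?W. k)" using deg by (intro sum_mono)
  also have "\<dots> = 2 * card M * k" using cW by simp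
  finally show ?thesis using cT by (simp add: algebra_simps)
qed

lemma card_le_Suc_degree_matching:
  assumes "finite S" "\<forall>e\<in>S. card e = 2"
    and "\<And>x. card {e\<in>S. x \<in> e} \<le> k" "max_matching S M"
  shows "card S \<le> (k + 1) * card M"
  using assms
proof (induction "card S" arbitrary: S M rule: less_induct)
  case less
  show ?case
  proof (cases "\<exists>w. \<forall>N. max_matching S N \<longrightarrow> w \<in> \<Union>N")
    case True
    then obtain w where w: "\<And>N. max_matching S N \<Longrightarrow> w \<in> \<Union>N" by blast
    obtain e where e: "e \<in> S" "w \<in> e"
      using w[OF less.prems(4)] max_matchingD(1)[OF less.prems(4)] by blast
    let ?T = "{e\<in>S. w \<notin> e}"
    \<comment> \<open>The degree bound is weakened to \<open>k + 1\<close> to match the factor in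
      the claim.\<close>
    have deg: "card {e\<in>S. w \<in> e} \<le> k + 1" using less.prems(3)[of w] by simp
    show ?thesis
    proof (rule card_le_delete_covered[OF less.prems(1) w deg less.prems(4)])
      fix L assume L: "max_matching ?T L"
      show "card ?T \<le> (k + 1) * card L"
      proof (rule less.hyps[OF _ _ _ _ L])
        show "card ?T < card S" by (rule card_delete_less[OF less.prems(1) e])
        show "card {e\<in>?T. x \<in> e} \<le> k" for x
          by (rule card_deg_subset[OF less.prems(1) _ less.prems(3)]) auto
      qed (use less.prems in auto)
    qed
  next
    case False
    then show ?thesis using card_le_no_essential_vertex[OF less.prems] by blast
  qed
qed

section \<open>Matching costs\<close>

lemma matching_cost_empty: "matching_cost ({} :: 'v set set) = 0"
proof -
  obtain M :: "'v set set" where "max_matching {} M" "matching_cost ({} :: 'v set set) = card M"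
    using matching_cost_attained[OF finite.emptyI] .
  then show ?thesis using max_matchingD(1) by force
qed

text \<open>Removing \<open>i\<close> from a maximum matching of the larger set leaves a matching in
  \<open>S\<close>.\<close>

lemma matching_cost_insert_le:
  assumes "finite S"
  shows "matching_cost (insert i S) \<le> matching_cost S + 1"
proof -
  obtain M where M: "max_matching S M" "matching_cost S = card M"
    using matching_cost_attained[OF assms] .
  have "finite (insert i S)" using assms by simp
  then obtain N where N: "max_matching (insert i S) N" "matching_cost (insert i S) = card N"
    using matching_cost_attained by blast
  have "card (N - {i}) \<le> card M"
    using max_matchingD(1,2)[OF N(1)]
    by (intro max_matchingD(3)[OF M(1)]) (auto simp: is_matching_def)
  then have "card N \<le> card M + 1" by (auto simp: card_Diff_singleton_if split: if_splits)
  then show ?thesis using M(2) N(2) by simp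
qed

lemma max_degree_le_subset:
  assumes "simple_graph V E" "max_degree_le V E k" "S \<subseteq> E"
  shows "card {e\<in>S. x \<in> e} \<le> k"
proof (rule card_deg_subset[OF simple_graph_finite[OF assms(1)] assms(3)])
  show "card {e\<in>E. x \<in> e} \<le> k"
  proof (cases "x \<in> V")
    case False
    then have "{e\<in>E. x \<in> e} = {}" using assms(1) unfolding simple_graph_def by auto
    then show ?thesis by (simp only: card.empty)
  qed (use assms(2) in \<open>auto simp: max_degree_le_def degree_def\<close>)
qed

text \<open>\<open>bound\<close> is asked for nonempty \<open>S\<close> only, so that its proof may
  use \<open>k \<ge> 1\<close>; the empty set has cost 0.\<close>

lemma matching_seq_approxI:
  fixes \<alpha> :: real
  assumes E: "finite E" and \<alpha>: "E \<noteq> {} \<Longrightarrow> 1 \<le> \<alpha>"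
    and bound: "\<And>S M. S \<subseteq> E \<Longrightarrow> S \<noteq> {} \<Longrightarrow> max_matching S M \<Longrightarrow> card S \<le> \<alpha> * card M"
  shows "seq_approx \<alpha> matching_cost E"
proof (rule seq_approxI)
  show c0: "matching_cost {} = 0" by (rule matching_cost_empty)
  fix S assume S: "S \<subseteq> E"
  then have fin: "finite S" using E finite_subset by blast
  show "matching_cost (insert i S) \<le> matching_cost S + 1" for i
    by (rule matching_cost_insert_le[OF fin])
  show "real (card S) \<le> \<alpha> * matching_cost S"
  proof (cases "S = {}")
    case False
    obtain M where "max_matching S M" "matching_cost S = card M"
      using matching_cost_attained[OF fin] .
    then show ?thesis using bound[OF S False] by simp
  qed (simp add: c0)
qed (use \<alpha> in auto)

lemma bipartite_matching_seq_approx: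
  assumes g: "simple_graph V E" and "bipartite V E" and deg: "max_degree_le V E k"
  shows "seq_approx (real k) matching_cost E"
proof (rule matching_seq_approxI)
  show fin: "finite E" by (rule simple_graph_finite[OF g])
  obtain A B where AB: "A \<inter> B = {}" "\<forall>e\<in>E. \<exists>a\<in>A. \<exists>b\<in>B. e = {a, b}"
    using assms(2) unfolding bipartite_def by blast
  fix S M assume S: "S \<subseteq> E" and M: "max_matching S M"
  have "card S \<le> k * card M"
  proof (rule bipartite_card_le[OF _ _ AB(1) max_degree_le_subset[OF g deg S] M])
    show "finite S" using S fin finite_subset by blast
    show "\<forall>e\<in>S. \<exists>a\<in>A. \<exists>b\<in>B. e = {a, b}" using S AB(2) by blast
  qed
  then show "real (card S) \<le> real k * real (card M)" by (metis of_nat_le_iff of_nat_mult)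
qed (use simple_graph_max_degree_pos[OF g deg] in simp)

lemma matching_seq_approx:
  assumes g: "simple_graph V E" and deg: "max_degree_le V E k"
  shows "seq_approx ((5 * real k + 3) / 4) matching_cost E"
proof (rule matching_seq_approxI)
  show fin: "finite E" by (rule simple_graph_finite[OF g])
  fix S M assume S: "S \<subseteq> E" "S \<noteq> {}" and M: "max_matching S M"
  have k: "1 \<le> k" using simple_graph_max_degree_pos[OF g deg] S by blast
  have "card S \<le> (k + 1) * card M"
  proof (rule card_le_Suc_degree_matching[OF _ _ max_degree_le_subset[OF g deg S(1)] M])
    show "finite S" using S fin finite_subset by blast
    show "\<forall>e\<in>S. card e = 2" using S g unfolding simple_graph_def by blast
  qed
  then have "real (card S) \<le> (real k + 1) * real (card M)"
    by (metis of_nat_1 of_nat_add of_nat_le_iff of_nat_mult)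
  \<comment> \<open>The comparison of factors amounts to \<open>4 * k + 4 \<le> 5 * k + 3\<close>,
    that is \<open>k \<ge> 1\<close>.\<close>
  also have "\<dots> \<le> (5 * real k + 3) / 4 * real (card M)"
    using k by (intro mult_right_mono) auto
  finally show "real (card S) \<le> (5 * real k + 3) / 4 * real (card M)" .
qed (use simple_graph_max_degree_pos[OF g deg] in simp)

theorem mainTheorem15:
  shows "(\<forall>(U :: 'a set) (F :: 'a set set) (d :: nat).
            finite U \<and> F \<subseteq> Pow U \<and> \<Union>F = U \<and> (\<forall>S\<in>F. card S \<le> d)
            \<longrightarrow> seq_approx (real d) (setcover_cost F) U)
       \<and> (\<forall>(V :: 'v set) (E :: 'v set set) (k :: nat).
            simple_graph V E \<and> max_degree_le V E k
            \<longrightarrow> seq_approx (real k) (vc_cost V) E)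
       \<and> (\<forall>(V :: 'w set) (E :: 'w set set) (k :: nat).
            simple_graph V E \<and> bipartite V E \<and> max_degree_le V E k
            \<longrightarrow> seq_approx (real k) matching_cost E)
       \<and> (\<forall>(V :: 'x set) (E :: 'x set set) (k :: nat).
            simple_graph V E \<and> max_degree_le V E k
            \<longrightarrow> seq_approx ((5 * real k + 3) / 4) matching_cost E)"
  by (intro conjI allI impI; elim conjE)
    (rule setcover_seq_approx vc_seq_approx bipartite_matching_seq_approx matching_seq_approx;
      assumption)+

end
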